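(* Fix $(\lambda,\theta)\in\Lambda\times\Theta$ and let $X\sim P_\theta$. If the kernel $K_\lambda(t)=\partial_\lambda\log w_{\lambda,\theta}(t)$ does not depend on $\theta$, then, with $L_\theta(t)=\partial_\theta\log w_{\lambda,\theta}(t)$, $$\partial_\theta\partial_\lambda\log\Phi(\lambda,\theta)=\operatorname{Cov}\bigl(K_\lambda(X),L_\theta(X)\bigr).$$
   Context: Setting. $\Lambda,\Theta\subseteq\mathbb R$ are intervals, and $J$ is either an interval of $\mathbb R$, equipped with Lebesgue measure $\mu$, or a subset of $\mathbb N_0=\{0,1,2,\dots\}$, equipped with counting measure $\mu$. For $(\lambda,\theta)\in\Lambda\times\Theta$, $w_{\lambda,\theta}:J\to(0,\infty)$ is a (measurable) positive weight function, and $\Phi(\lambda,\theta)=\int_J w_{\lambda,\theta}(t)\,d\mu(t)$ is assumed finite and positive. For given $\lambda$, $P_\theta$ is the probability law on $J$ with density $w_{\lambda,\theta}/\Phi(\lambda,\theta)$ with respect to $\mu$. Standing regularity assumptions. (1) For each parameter $r\in\{\lambda,\theta\}$, with the other parameter fixed, $r\mapsto\log w_{\lambda,\theta}(t)$ is $C^1$ for every $t\in J$, and for every compact interval $B$ in the domain of $r$ there is $m_B\in L^1(J,\mu)$ with $\sup_{r\in B}|\partial_r w_{\lambda,\theta}(t)|\le m_B(t)$ for $\mu$-a.e. $t\in J$. (2) The map $(\lambda,\theta)\mapsto\log w_{\lambda,\theta}(t)$ is $C^2$ on $\Lambda\times\Theta$ for every $t\in J$, and for every compact rectangle $B\subseteq\Lambda\times\Theta$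 there is $m_B\in L^1(J,\mu)$ with $\sup_{(\lambda,\theta)\in B}|\partial_\lambda\partial_\theta w_{\lambda,\theta}(t)|\le m_B(t)$ for $\mu$-a.e. $t\in J$. *)

theory Defs
  imports "HOL-Probability.Probability"
begin

text \<open>
  Derivatives are taken relative to the parameter intervals, hence they are one-sided at
  endpoints that belong to the interval and ordinary derivatives in the interior.
\<close>

definition partial1 :: "real set \<Rightarrow> (real \<Rightarrow> real \<Rightarrow> real) \<Rightarrow> real \<Rightarrow> real \<Rightarrow> real" where
  "partial1 A f x y = vector_derivative (\<lambda>u. f u y) (at x within A)"

definition partial2 :: "real set \<Rightarrow> (real \<Rightarrow> real \<Rightarrow> real) \<Rightarrow> real \<Rightarrow> real \<Rightarrow> real" where
  "partial2 B f x y = vector_derivative (\<lambda>v. f x v) (at y within B)"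

definition C1_on :: "real set \<Rightarrow> (real \<Rightarrow> real) \<Rightarrow> bool" where
  "C1_on A f \<longleftrightarrow>
     f differentiable_on A \<and> continuous_on A (\<lambda>x. vector_derivative f (at x within A))"

definition C1_on_rect :: "real set \<Rightarrow> real set \<Rightarrow> (real \<Rightarrow> real \<Rightarrow> real) \<Rightarrow> bool" where
  "C1_on_rect A B f \<longleftrightarrow>
     continuous_on (A \<times> B) (\<lambda>(x, y). f x y) \<and>
     (\<forall>y\<in>B. (\<lambda>x. f x y) differentiable_on A) \<and>
     (\<forall>x\<in>A. (\<lambda>y. f x y) differentiable_on B) \<and>
     continuous_on (A \<times> B) (\<lambda>(x, y). partial1 A f x y) \<and>
     continuous_on (A \<times> B) (\<lambda>(x, y). partial2 B f x y)"

definition C2_on_rect :: "real set \<Rightarrow> real set \<Rightarrow> (real \<Rightarrow> real \<Rightarrow> real) \<Rightarrow> bool" where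
  "C2_on_rect A B f \<longleftrightarrow>
     C1_on_rect A B f \<and> C1_on_rect A B (partial1 A f) \<and> C1_on_rect A B (partial2 B f)"

text \<open>
  Both kinds of state space are subsets of the reals; a set of natural numbers is regarded as a
  subset of \<^term>\<open>\<nat> :: real set\<close>. The measure \<^term>\<open>\<mu>\<close> has space \<^term>\<open>J\<close>.
\<close>

definition state_space :: "real set \<Rightarrow> real measure \<Rightarrow> bool" where
  "state_space J \<mu> \<longleftrightarrow>
     (is_interval J \<and> \<mu> = lebesgue_on J) \<or> (J \<subseteq> \<nat> \<and> \<mu> = count_space J)"

definition Phi ::
    "real measure \<Rightarrow> (real \<Rightarrow> real \<Rightarrow> real \<Rightarrow> real) \<Rightarrow> real \<Rightarrow> real \<Rightarrow> real" where
  "Phi \<mu> w lam \<theta> = (\<integral>t. w lam \<theta> t \<partial>\<mu>)"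

definition law ::
    "real measure \<Rightarrow> (real \<Rightarrow> real \<Rightarrow> real \<Rightarrow> real) \<Rightarrow> real \<Rightarrow> real \<Rightarrow> real measure" where
  "law \<mu> w lam \<theta> = density \<mu> (\<lambda>t. ennreal (w lam \<theta> t / Phi \<mu> w lam \<theta>))"

definition K_kernel ::
    "real set \<Rightarrow> (real \<Rightarrow> real \<Rightarrow> real \<Rightarrow> real) \<Rightarrow> real \<Rightarrow> real \<Rightarrow> real \<Rightarrow> real" where
  "K_kernel \<Lambda> w lam \<theta> t = partial1 \<Lambda> (\<lambda>l h. ln (w l h t)) lam \<theta>"

definition L_kernel ::
    "real set \<Rightarrow> (real \<Rightarrow> real \<Rightarrow> real \<Rightarrow> real) \<Rightarrow> real \<Rightarrow> real \<Rightarrow> real \<Rightarrow> real" where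
  "L_kernel \<Theta> w lam \<theta> t = partial2 \<Theta> (\<lambda>l h. ln (w l h t)) lam \<theta>"

definition covariance :: "'a measure \<Rightarrow> ('a \<Rightarrow> real) \<Rightarrow> ('a \<Rightarrow> real) \<Rightarrow> real" where
  "covariance M U V =
     (\<integral>\<omega>. (U \<omega> - (\<integral>\<omega>'. U \<omega>' \<partial>M)) * (V \<omega> - (\<integral>\<omega>'. V \<omega>' \<partial>M)) \<partial>M)"

text \<open>
  The parameter intervals are nondegenerate, since a derivative with respect to a parameter
  ranging over a single point is meaningless. In the domination hypotheses the bound on the
  supremum is expressed as a pointwise bound, and all values of the parameter in the compact set
  share the same null set. Compact intervals (rectangles) are allowed to be degenerate or empty,
  which adds nothing to the hypotheses.
\<close>

locale weight_family =
  fixes \<Lambda> \<Theta> J :: "real set"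
    and \<mu> :: "real measure"
    and w :: "real \<Rightarrow> real \<Rightarrow> real \<Rightarrow> real"
  assumes interval_Lambda: "is_interval \<Lambda>" "interior \<Lambda> \<noteq> {}"
    and interval_Theta: "is_interval \<Theta>" "interior \<Theta> \<noteq> {}"
    and state_space: "state_space J \<mu>"
    and w_pos: "\<lbrakk>lam \<in> \<Lambda>; \<theta> \<in> \<Theta>; t \<in> J\<rbrakk> \<Longrightarrow> w lam \<theta> t > 0"
    and w_measurable: "\<lbrakk>lam \<in> \<Lambda>; \<theta> \<in> \<Theta>\<rbrakk> \<Longrightarrow> w lam \<theta> \<in> borel_measurable \<mu>"
    and w_integrable: "\<lbrakk>lam \<in> \<Lambda>; \<theta> \<in> \<Theta>\<rbrakk> \<Longrightarrow> integrable \<mu> (w lam \<theta>)"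
    and Phi_pos: "\<lbrakk>lam \<in> \<Lambda>; \<theta> \<in> \<Theta>\<rbrakk> \<Longrightarrow> Phi \<mu> w lam \<theta> > 0"
    and C1_lam: "\<lbrakk>\<theta> \<in> \<Theta>; t \<in> J\<rbrakk> \<Longrightarrow> C1_on \<Lambda> (\<lambda>lam. ln (w lam \<theta> t))"
    and dominated_lam: "\<lbrakk>\<theta> \<in> \<Theta>; {a..b} \<subseteq> \<Lambda>\<rbrakk> \<Longrightarrow>
      \<exists>m. integrable \<mu> m \<and>
        (AE t in \<mu>. \<forall>lam\<in>{a..b}. \<bar>partial1 \<Lambda> (\<lambda>l h. w l h t) lam \<theta>\<bar> \<le> m t)"
    and C1_theta: "\<lbrakk>lam \<in> \<Lambda>; t \<in> J\<rbrakk> \<Longrightarrow> C1_on \<Theta> (\<lambda>\<theta>. ln (w lam \<theta> t))"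
    and dominated_theta: "\<lbrakk>lam \<in> \<Lambda>; {c..d} \<subseteq> \<Theta>\<rbrakk> \<Longrightarrow>
      \<exists>m. integrable \<mu> m \<and>
        (AE t in \<mu>. \<forall>\<theta>\<in>{c..d}. \<bar>partial2 \<Theta> (\<lambda>l h. w l h t) lam \<theta>\<bar> \<le> m t)"
    and C2: "t \<in> J \<Longrightarrow> C2_on_rect \<Lambda> \<Theta> (\<lambda>lam \<theta>. ln (w lam \<theta> t))"
    and dominated_lam_theta: "{a..b} \<times> {c..d} \<subseteq> \<Lambda> \<times> \<Theta> \<Longrightarrow>
      \<exists>m. integrable \<mu> m \<and>
        (AE t in \<mu>. \<forall>lam\<in>{a..b}. \<forall>\<theta>\<in>{c..d}.
           \<bar>partial1 \<Lambda> (partial2 \<Theta> (\<lambda>l h. w l h t)) lam \<theta>\<bar> \<le> m t)"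

end

theory Submission
  imports Defs
begin

text \<open>
  Since \<open>\<partial>\<^sub>\<lambda> w = K w\<close>, differentiating \<open>\<Phi> = \<integral> w d\<mu>\<close> under the integral sign gives
  \<open>\<partial>\<^sub>\<lambda> log \<Phi> = (\<integral> K w d\<mu>) / \<Phi>\<close>, the mean of \<open>K\<close> under the law. At the given \<open>\<lambda>\<close> the function
  \<open>K\<close> is the same for all \<open>\<theta>\<close>, so the numerator depends on \<open>\<theta>\<close> only through \<open>w\<close>, and since
  \<open>\<partial>\<^sub>\<theta> w = L w\<close> its derivative is \<open>\<integral> K L w d\<mu>\<close>. The quotient rule then gives
  \<open>E(K L) - E(K) E(L)\<close>, which is the covariance.

  The delicate point is the domination needed for the second differentiation. The hypotheses bound
  \<open>\<partial>\<^sub>\<lambda> \<partial>\<^sub>\<theta> w = (K L + \<partial>\<^sub>\<lambda> L) w\<close>, whereas the integrand to be dominated is \<open>K L w\<close>. The two agree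
  because \<open>\<partial>\<^sub>\<lambda> L = \<partial>\<^sub>\<lambda> \<partial>\<^sub>\<theta> log w = \<partial>\<^sub>\<theta> \<partial>\<^sub>\<lambda> log w = \<partial>\<^sub>\<theta> K = 0\<close> by the symmetry of second
  derivatives (\<open>mixed_partial_w\<close>). The independence of \<open>\<theta>\<close> is assumed at the given \<open>\<lambda>\<close> alone, so
  the agreement is guaranteed only there; the domination hypothesis is accordingly applied to the
  degenerate rectangle \<open>{\<lambda>} \<times> {c..d}\<close>.

  Parameters may be endpoints of their intervals. Hence the two analytic tools, the Leibniz rule
  for a dominated integral (\<open>has_real_derivative_dominated_integral\<close>) and the symmetry of second
  derivatives (\<open>partial_derivatives_commute\<close>), are proved for derivatives within an interval.
\<close>

section \<open>One-sided derivatives on nondegenerate intervals\<close>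

text \<open>
  Derivatives within \<open>S\<close> are thereby reduced to derivatives within a compact interval, where the
  domination hypotheses and the fundamental theorem of calculus apply.
\<close>

lemma interval_compact_neighbourhood:
  fixes S :: "real set"
  assumes "is_interval S" "interior S \<noteq> {}" "x \<in> S"
  obtains a b where "a < b" "x \<in> {a..b}" "{a..b} \<subseteq> S" "at x within S = at x within {a..b}"
proof -
  have "\<exists>a\<in>S. a \<le> x \<and> (\<forall>u\<in>S. u < x \<longrightarrow> a < x)"
  proof (cases "\<exists>a\<in>S. a < x")
    case True
    then obtain a where "a \<in> S" "a < x" by blast
    then show ?thesis by (intro bexI[of _ a]) auto
  qed (use assms(3) in blast)
  then obtain a where a: "a \<in> S" "a \<le> x" "\<And>u. u \<in> S \<Longrightarrow> u < x \<Longrightarrow> a < x"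
    by blast
  have "\<exists>b\<in>S. x \<le> b \<and> (\<forall>u\<in>S. x < u \<longrightarrow> x < b)"
  proof (cases "\<exists>b\<in>S. x < b")
    case True
    then obtain b where "b \<in> S" "x < b" by blast
    then show ?thesis by (intro bexI[of _ b]) auto
  qed (use assms(3) in blast)
  then obtain b where b: "b \<in> S" "x \<le> b" "\<And>u. u \<in> S \<Longrightarrow> x < u \<Longrightarrow> x < b"
    by blast
  have "\<not> S \<subseteq> {x}"
    using assms(2) interior_mono[of S "{x}"] by auto
  then obtain u where "u \<in> S" "u \<noteq> x" by auto
  then have "a < b"
    using a(2) b(2) a(3)[of u] b(3)[of u] by linarith
  have sub: "{a..b} \<subseteq> S"
    using interval_subset_is_interval[OF assms(1), of a b] a(1) b(1) by simp
  \<comment> \<open>On a side of \<open>x\<close> where \<open>S\<close> has no points, the open set that localises may reach any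
    distance beyond \<open>x\<close>.\<close>
  define T where "T = {(if a < x then a else x - 1) <..< (if x < b then b else x + 1)}"
  have T: "open T" "x \<in> T"
    unfolding T_def by auto
  have ST: "S \<inter> T - {x} = {a..b} \<inter> T - {x}"
  proof (intro equalityI subsetI)
    fix u assume u: "u \<in> S \<inter> T - {x}"
    then have "u < x \<or> x < u" by auto
    then have "a \<le> u" "u \<le> b"
      using u a b unfolding T_def by (auto split: if_splits)
    with u show "u \<in> {a..b} \<inter> T - {x}" by auto
  qed (use sub in auto)
  have "at x within S = at x within {a..b}"
    using at_within_nhd[OF T(2,1) ST] .
  with \<open>a < b\<close> sub a(2) b(2) show ?thesis
    by (intro that[of a b]) auto
qed

lemma interval_islimpt:
  fixes S :: "real set"
  assumes "is_interval S" "interior S \<noteq> {}" "x \<in> S"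
  shows "x islimpt S"
proof -
  have "S \<noteq> {y}" for y
    using assms(2) by auto
  then show ?thesis
    using assms connected_imp_perfect is_interval_connected by blast
qed

lemma interval_at_within_neq_bot:
  fixes S :: "real set"
  assumes "is_interval S" "interior S \<noteq> {}" "x \<in> S"
  shows "at x within S \<noteq> bot"
  using interval_islimpt[OF assms] by (simp add: trivial_limit_within)

lemma vector_derivative_within_interval_eq:
  fixes f :: "real \<Rightarrow> real"
  assumes "is_interval S" "interior S \<noteq> {}" "x \<in> S"
    and "(f has_real_derivative D) (at x within S)"
  shows "vector_derivative f (at x within S) = D"
  using vector_derivative_within[OF interval_at_within_neq_bot[OF assms(1-3)]] assms(4)
  by (simp add: has_real_derivative_iff_has_vector_derivative)

lemma has_real_derivative_vector_derivative:
  fixes f :: "real \<Rightarrow> real"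
  assumes "f differentiable (at x within S)"
  shows "(f has_real_derivative vector_derivative f (at x within S)) (at x within S)"
  using assms vector_derivative_works has_real_derivative_iff_has_vector_derivative by blast

section \<open>Differentiation under a dominated integral\<close>

text \<open>
  By the mean value inequality a bound on the derivative over a compact neighbourhood bounds all
  difference quotients based at \<open>x\<close>, so dominated convergence applies to them along any sequence
  tending to \<open>x\<close>. The limit inherits measurability from the quotients and integrability
  from the bound.
\<close>

lemma
  fixes f f' :: "real \<Rightarrow> 'a \<Rightarrow> real"
  assumes S: "is_interval S" "interior S \<noteq> {}" "x \<in> S"
    and int: "\<And>u. u \<in> S \<Longrightarrow> integrable N (f u)"
    and der: "\<And>u t. u \<in> S \<Longrightarrow> t \<in> space N \<Longrightarrow>
      ((\<lambda>u. f u t) has_real_derivative f' u t) (at u within S)"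
    and dom: "\<And>a b. {a..b} \<subseteq> S \<Longrightarrow>
      \<exists>m. integrable N m \<and> (AE t in N. \<forall>u\<in>{a..b}. \<bar>f' u t\<bar> \<le> m t)"
  shows integrable_dominated_derivative: "integrable N (f' x)"
    and has_real_derivative_dominated_integral:
      "((\<lambda>u. \<integral>t. f u t \<partial>N) has_real_derivative (\<integral>t. f' x t \<partial>N)) (at x within S)"
proof -
  obtain a b where ab: "x \<in> {a..b}" "{a..b} \<subseteq> S" "at x within S = at x within {a..b}" "a < b"
    using interval_compact_neighbourhood[OF S] by metis
  obtain m where m: "integrable N m" "AE t in N. \<forall>u\<in>{a..b}. \<bar>f' u t\<bar> \<le> m t"
    using dom[OF ab(2)] by auto
  define q where "q u t = (f u t - f x t) / (u - x)" for u t
  have q_int: "integrable N (q u)" if "u \<in> S" for u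
    unfolding q_def using int that S(3) by auto
  have q_lim: "((\<lambda>u. q u t) \<longlongrightarrow> f' x t) (at x within {a..b})" if "t \<in> space N" for t
    using der[OF S(3) that] unfolding has_field_derivative_iff q_def ab(3) .
  have q_bound: "AE t in N. \<forall>u\<in>{a..b} - {x}. \<bar>q u t\<bar> \<le> m t"
    using m(2) AE_space
  proof eventually_elim
    case (elim t)
    have "norm (f u t - f x t) \<le> m t * norm (u - x)" if "u \<in> {a..b}" for u
    proof (rule field_differentiable_bound[of "{a..b}" "\<lambda>u. f u t" "\<lambda>u. f' u t"])
      fix v assume "v \<in> {a..b}"
      then show "((\<lambda>u. f u t) has_real_derivative f' v t) (at v within {a..b})"
        using ab(2) elim(2) by (intro DERIV_subset[OF der]) auto
    qed (use that ab elim in auto)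
    then show ?case
      unfolding q_def by (auto simp: abs_divide field_simps)
  qed
  have *: "integrable N (f' x) \<and> (\<lambda>n. \<integral>t. q (X n) t \<partial>N) \<longlonglongrightarrow> (\<integral>t. f' x t \<partial>N)"
    if X: "\<forall>n. X n \<in> {a..b} - {x}" "X \<longlonglongrightarrow> x" for X
  proof -
    have lim: "(\<lambda>n. q (X n) t) \<longlonglongrightarrow> f' x t" if "t \<in> space N" for t
      using q_lim[OF that] X unfolding tendsto_at_iff_sequentially comp_def by blast
    have meas: "q (X n) \<in> borel_measurable N" for n
      using X(1) ab(2) by (intro borel_measurable_integrable q_int) auto
    have meas': "f' x \<in> borel_measurable N"
      by (rule borel_measurable_LIMSEQ_real[OF lim meas])
    have bound: "AE t in N. norm (q (X n) t) \<le> m t" for n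
      using q_bound by eventually_elim (use X(1) in auto)
    have limAE: "AE t in N. (\<lambda>n. q (X n) t) \<longlonglongrightarrow> f' x t"
      using lim by (intro AE_I2)
    show ?thesis
      using integrable_dominated_convergence[OF meas' meas m(1) limAE bound]
        integral_dominated_convergence[OF meas' meas m(1) limAE bound] by simp
  qed
  have "x islimpt {a..b}"
    using interval_islimpt[of "{a..b}" x] ab by (simp add: is_interval_cc)
  then obtain X where "\<forall>n. X n \<in> {a..b} - {x}" "X \<longlonglongrightarrow> x"
    unfolding islimpt_sequential by blast
  with * show "integrable N (f' x)" by blast
  have "((\<lambda>u. \<integral>t. q u t \<partial>N) \<longlongrightarrow> (\<integral>t. f' x t \<partial>N)) (at x within {a..b})"
    unfolding tendsto_at_iff_sequentially comp_def using * by blast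
  moreover have "\<forall>\<^sub>F u in at x within {a..b}.
      (\<integral>t. q u t \<partial>N) = ((\<integral>t. f u t \<partial>N) - (\<integral>t. f x t \<partial>N)) / (u - x)"
    unfolding eventually_at_filter q_def using int ab(2) S(3)
    by (intro always_eventually) (auto simp: Bochner_Integration.integral_diff subset_iff)
  ultimately show "((\<lambda>u. \<integral>t. f u t \<partial>N) has_real_derivative (\<integral>t. f' x t \<partial>N)) (at x within S)"
    unfolding has_field_derivative_iff ab(3) using tendsto_cong by fastforce
qed

section \<open>Symmetry of second derivatives up to the boundary\<close>

text \<open>
  On a compact interval with left end \<open>c\<close>, the increment \<open>f u v - f u c\<close> is the integral of
  \<open>partial2 B f u\<close> over \<open>{c..v}\<close>. Differentiating this in \<open>u\<close> under the integral expresses the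
  increment of \<open>partial1 A f x\<close> as the integral of the continuous function
  \<open>partial1 A (partial2 B f) x\<close>, and differentiating the result in \<open>v\<close> recovers that function.
  Nothing changes when \<open>(x, y)\<close> lies on an edge or at a corner of the rectangle.
\<close>

lemma partial_derivatives_commute:
  assumes A: "is_interval A" "interior A \<noteq> {}" "x \<in> A"
    and B: "is_interval B" "interior B \<noteq> {}" "y \<in> B"
    and f: "C2_on_rect A B f"
  shows "partial1 A (partial2 B f) x y = partial2 B (partial1 A f) x y"
proof -
  let ?g = "partial1 A (partial2 B f)"
  have d1: "(\<lambda>u. f u v) differentiable (at u within A)" if "u \<in> A" "v \<in> B" for u v
    using f that unfolding C2_on_rect_def C1_on_rect_def differentiable_on_def by auto
  have d2: "(\<lambda>v. f u v) differentiable (at v within B)" if "u \<in> A" "v \<in> B" for u v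
    using f that unfolding C2_on_rect_def C1_on_rect_def differentiable_on_def by auto
  have d21: "(\<lambda>u. partial2 B f u v) differentiable (at u within A)" if "u \<in> A" "v \<in> B" for u v
    using f that unfolding C2_on_rect_def C1_on_rect_def differentiable_on_def by auto
  have cont2: "continuous_on (A \<times> B) (\<lambda>(u, v). partial2 B f u v)"
    using f unfolding C2_on_rect_def C1_on_rect_def by auto
  have cont21: "continuous_on (A \<times> B) (\<lambda>(u, v). ?g u v)"
    using f unfolding C2_on_rect_def C1_on_rect_def by auto
  have slice: "continuous_on T (h u)"
    if "continuous_on (A \<times> B) (\<lambda>(u, v). h u v)" "u \<in> A" "T \<subseteq> B"
    for h :: "real \<Rightarrow> real \<Rightarrow> real" and u T
  proof -
    have "continuous_on T (\<lambda>v. (\<lambda>(u, v). h u v) (u, v))"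
      by (rule continuous_on_compose2[OF that(1)]) (use that(2,3) in \<open>auto intro!: continuous_intros\<close>)
    then show ?thesis by simp
  qed
  obtain c d where cd: "y \<in> {c..d}" "{c..d} \<subseteq> B" "at y within B = at y within {c..d}" "c < d"
    using interval_compact_neighbourhood[OF B] by metis
  have increment: "f u v - f u c = integral {c..v} (partial2 B f u)"
    if "u \<in> A" "v \<in> {c..d}" for u v
  proof -
    have "(partial2 B f u has_integral f u v - f u c) {c..v}"
    proof (rule fundamental_theorem_of_calculus)
      fix s assume s: "s \<in> {c..v}"
      have "((\<lambda>v. f u v) has_real_derivative partial2 B f u s) (at s within B)"
        unfolding partial2_def
        using s that cd(2) by (intro has_real_derivative_vector_derivative d2) auto
      then show "((\<lambda>v. f u v) has_vector_derivative partial2 B f u s) (at s within {c..v})"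
        unfolding has_real_derivative_iff_has_vector_derivative
        by (rule has_vector_derivative_within_subset) (use that cd(2) in auto)
    qed (use that in auto)
    then show ?thesis by (simp add: integral_unique)
  qed
  have slope_increment: "partial1 A f x v = partial1 A f x c + integral {c..v} (?g x)"
    if v: "v \<in> {c..d}" for v
  proof -
    have sub: "{c..v} \<subseteq> B" using v cd(2) by auto
    have under_integral: "((\<lambda>u. integral (cbox c v) (partial2 B f u)) has_real_derivative
        integral (cbox c v) (?g x)) (at x within A)"
    proof (rule leibniz_rule_field_derivative)
      fix u s assume us: "u \<in> A" "s \<in> cbox c v"
      show "((\<lambda>u. partial2 B f u s) has_real_derivative ?g u s) (at u within A)"
        unfolding partial1_def
        using us sub by (intro has_real_derivative_vector_derivative d21) auto
    next
      fix u assume "u \<in> A"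
      then show "partial2 B f u integrable_on cbox c v"
        using slice[OF cont2 _ sub] by (auto intro: integrable_continuous_interval)
    next
      show "continuous_on (A \<times> cbox c v) (\<lambda>(u, s). ?g u s)"
        by (rule continuous_on_subset[OF cont21]) (use sub in auto)
    qed (use A in \<open>auto simp: is_interval_convex_1\<close>)
    have "((\<lambda>u. f u v - f u c) has_real_derivative
        partial1 A f x v - partial1 A f x c) (at x within A)"
      unfolding partial1_def using A(3) v cd
      by (intro DERIV_diff has_real_derivative_vector_derivative d1) auto
    then have "((\<lambda>u. integral (cbox c v) (partial2 B f u)) has_real_derivative
        partial1 A f x v - partial1 A f x c) (at x within A)"
      by (rule has_field_derivative_transform_within[where d = 1])
        (use A(3) increment v in auto)
    from vector_derivative_within_interval_eq[OF A this]
      vector_derivative_within_interval_eq[OF A under_integral]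
    show ?thesis by simp
  qed
  have "((\<lambda>v. integral {c..v} (?g x)) has_real_derivative ?g x y) (at y within {c..d})"
    unfolding has_real_derivative_iff_has_vector_derivative
    by (rule integral_has_vector_derivative[OF slice[OF cont21 A(3) cd(2)] cd(1)])
  then have "((\<lambda>v. partial1 A f x c + integral {c..v} (?g x)) has_real_derivative ?g x y)
      (at y within {c..d})"
    by (auto intro!: derivative_eq_intros)
  then have "((\<lambda>v. partial1 A f x v) has_real_derivative ?g x y) (at y within B)"
    unfolding cd(3)
    by (rule has_field_derivative_transform_within[where d = 1])
      (use cd(1) in \<open>auto intro: slope_increment[symmetric]\<close>)
  then show ?thesis
    using vector_derivative_within_interval_eq[OF B] by (simp add: partial2_def)
qed

section \<open>Score functions and derivatives of the normalising constant\<close>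

context weight_family
begin

lemma space_mu: "space \<mu> = J"
  using state_space unfolding state_space_def by auto

lemma ln_w_differentiable:
  assumes "lam \<in> \<Lambda>" "\<theta> \<in> \<Theta>" "t \<in> J"
  shows "(\<lambda>l. ln (w l \<theta> t)) differentiable (at lam within \<Lambda>)"
    and "(\<lambda>h. ln (w lam h t)) differentiable (at \<theta> within \<Theta>)"
  using C1_lam[OF assms(2,3)] C1_theta[OF assms(1,3)] assms
  unfolding C1_on_def differentiable_on_def by auto

lemma has_derivative_w_lam:
  assumes "lam \<in> \<Lambda>" "\<theta> \<in> \<Theta>" "t \<in> J"
  shows "((\<lambda>l. w l \<theta> t) has_real_derivative K_kernel \<Lambda> w lam \<theta> t * w lam \<theta> t) (at lam within \<Lambda>)"
proof -
  have "((\<lambda>l. ln (w l \<theta> t)) has_real_derivative K_kernel \<Lambda> w lam \<theta> t) (at lam within \<Lambda>)"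
    unfolding K_kernel_def partial1_def
    by (rule has_real_derivative_vector_derivative) (rule ln_w_differentiable[OF assms])
  then have "((\<lambda>l. exp (ln (w l \<theta> t))) has_real_derivative
      exp (ln (w lam \<theta> t)) * K_kernel \<Lambda> w lam \<theta> t) (at lam within \<Lambda>)"
    by (rule DERIV_chain2[OF DERIV_exp])
  then have "((\<lambda>l. w l \<theta> t) has_real_derivative
      exp (ln (w lam \<theta> t)) * K_kernel \<Lambda> w lam \<theta> t) (at lam within \<Lambda>)"
    by (rule has_field_derivative_transform_within[where d = 1])
      (use assms w_pos in auto)
  then show ?thesis using w_pos[OF assms] by (simp add: mult.commute)
qed

lemma has_derivative_w_theta:
  assumes "lam \<in> \<Lambda>" "\<theta> \<in> \<Theta>" "t \<in> J"
  shows "((\<lambda>h. w lam h t) has_real_derivative L_kernel \<Theta> w lam \<theta> t * w lam \<theta> t) (at \<theta> within \<Theta>)"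
proof -
  have "((\<lambda>h. ln (w lam h t)) has_real_derivative L_kernel \<Theta> w lam \<theta> t) (at \<theta> within \<Theta>)"
    unfolding L_kernel_def partial2_def
    by (rule has_real_derivative_vector_derivative) (rule ln_w_differentiable[OF assms])
  then have "((\<lambda>h. exp (ln (w lam h t))) has_real_derivative
      exp (ln (w lam \<theta> t)) * L_kernel \<Theta> w lam \<theta> t) (at \<theta> within \<Theta>)"
    by (rule DERIV_chain2[OF DERIV_exp])
  then have "((\<lambda>h. w lam h t) has_real_derivative
      exp (ln (w lam \<theta> t)) * L_kernel \<Theta> w lam \<theta> t) (at \<theta> within \<Theta>)"
    by (rule has_field_derivative_transform_within[where d = 1])
      (use assms w_pos in auto)
  then show ?thesis using w_pos[OF assms] by (simp add: mult.commute)
qed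

lemma partial1_w:
  assumes "lam \<in> \<Lambda>" "\<theta> \<in> \<Theta>" "t \<in> J"
  shows "partial1 \<Lambda> (\<lambda>l h. w l h t) lam \<theta> = K_kernel \<Lambda> w lam \<theta> t * w lam \<theta> t"
  unfolding partial1_def using has_derivative_w_lam[OF assms]
  by (intro vector_derivative_within_interval_eq interval_Lambda assms)

lemma partial2_w:
  assumes "lam \<in> \<Lambda>" "\<theta> \<in> \<Theta>" "t \<in> J"
  shows "partial2 \<Theta> (\<lambda>l h. w l h t) lam \<theta> = L_kernel \<Theta> w lam \<theta> t * w lam \<theta> t"
  unfolding partial2_def using has_derivative_w_theta[OF assms]
  by (intro vector_derivative_within_interval_eq interval_Theta assms)

lemma
  assumes "lam \<in> \<Lambda>" "\<theta> \<in> \<Theta>"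
  shows integrable_K_w: "integrable \<mu> (\<lambda>t. K_kernel \<Lambda> w lam \<theta> t * w lam \<theta> t)"
    and has_derivative_Phi_lam: "((\<lambda>l. Phi \<mu> w l \<theta>) has_real_derivative
      (\<integral>t. K_kernel \<Lambda> w lam \<theta> t * w lam \<theta> t \<partial>\<mu>)) (at lam within \<Lambda>)"
proof -
  have dom: "\<exists>m. integrable \<mu> m \<and>
      (AE t in \<mu>. \<forall>l\<in>{a..b}. \<bar>K_kernel \<Lambda> w l \<theta> t * w l \<theta> t\<bar> \<le> m t)"
    if ab: "{a..b} \<subseteq> \<Lambda>" for a b
  proof -
    obtain m where m: "integrable \<mu> m"
      "AE t in \<mu>. \<forall>l\<in>{a..b}. \<bar>partial1 \<Lambda> (\<lambda>l h. w l h t) l \<theta>\<bar> \<le> m t"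
      using dominated_lam[OF assms(2) ab] by auto
    have "AE t in \<mu>. \<forall>l\<in>{a..b}. \<bar>K_kernel \<Lambda> w l \<theta> t * w l \<theta> t\<bar> \<le> m t"
      using m(2) AE_space
    proof eventually_elim
      case (elim t)
      then show ?case using partial1_w[of _ \<theta> t] assms(2) ab by (fastforce simp: space_mu)
    qed
    with m(1) show ?thesis by blast
  qed
  note leibniz = interval_Lambda assms(1) w_integrable[OF _ assms(2)]
    has_derivative_w_lam[OF _ assms(2), folded space_mu] dom
  show "integrable \<mu> (\<lambda>t. K_kernel \<Lambda> w lam \<theta> t * w lam \<theta> t)"
    by (rule integrable_dominated_derivative[of \<Lambda> _ _ "\<lambda>l. w l \<theta>"]) (fact leibniz)+
  show "((\<lambda>l. Phi \<mu> w l \<theta>) has_real_derivative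
      (\<integral>t. K_kernel \<Lambda> w lam \<theta> t * w lam \<theta> t \<partial>\<mu>)) (at lam within \<Lambda>)"
    unfolding Phi_def
    by (rule has_real_derivative_dominated_integral) (fact leibniz)+
qed

lemma
  assumes "lam \<in> \<Lambda>" "\<theta> \<in> \<Theta>"
  shows integrable_L_w: "integrable \<mu> (\<lambda>t. L_kernel \<Theta> w lam \<theta> t * w lam \<theta> t)"
    and has_derivative_Phi_theta: "((\<lambda>h. Phi \<mu> w lam h) has_real_derivative
      (\<integral>t. L_kernel \<Theta> w lam \<theta> t * w lam \<theta> t \<partial>\<mu>)) (at \<theta> within \<Theta>)"
proof -
  have dom: "\<exists>m. integrable \<mu> m \<and>
      (AE t in \<mu>. \<forall>h\<in>{a..b}. \<bar>L_kernel \<Theta> w lam h t * w lam h t\<bar> \<le> m t)"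
    if ab: "{a..b} \<subseteq> \<Theta>" for a b
  proof -
    obtain m where m: "integrable \<mu> m"
      "AE t in \<mu>. \<forall>h\<in>{a..b}. \<bar>partial2 \<Theta> (\<lambda>l h. w l h t) lam h\<bar> \<le> m t"
      using dominated_theta[OF assms(1) ab] by auto
    have "AE t in \<mu>. \<forall>h\<in>{a..b}. \<bar>L_kernel \<Theta> w lam h t * w lam h t\<bar> \<le> m t"
      using m(2) AE_space
    proof eventually_elim
      case (elim t)
      then show ?case using partial2_w[of lam _ t] assms(1) ab by (fastforce simp: space_mu)
    qed
    with m(1) show ?thesis by blast
  qed
  note leibniz = interval_Theta assms(2) w_integrable[OF assms(1)]
    has_derivative_w_theta[OF assms(1), folded space_mu] dom
  show "integrable \<mu> (\<lambda>t. L_kernel \<Theta> w lam \<theta> t * w lam \<theta> t)"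
    by (rule integrable_dominated_derivative[of \<Theta> _ _ "\<lambda>h. w lam h"]) (fact leibniz)+
  show "((\<lambda>h. Phi \<mu> w lam h) has_real_derivative
      (\<integral>t. L_kernel \<Theta> w lam \<theta> t * w lam \<theta> t \<partial>\<mu>)) (at \<theta> within \<Theta>)"
    unfolding Phi_def
    by (rule has_real_derivative_dominated_integral) (fact leibniz)+
qed

lemma has_derivative_ln_Phi_lam:
  assumes "lam \<in> \<Lambda>" "\<theta> \<in> \<Theta>"
  shows "((\<lambda>l. ln (Phi \<mu> w l \<theta>)) has_real_derivative
    (\<integral>t. K_kernel \<Lambda> w lam \<theta> t * w lam \<theta> t \<partial>\<mu>) / Phi \<mu> w lam \<theta>) (at lam within \<Lambda>)"
  using has_derivative_Phi_lam[OF assms] Phi_pos[OF assms]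
  by (auto intro!: derivative_eq_intros)

text \<open>
  With \<open>K\<close> constant in \<open>\<theta>\<close> at this \<open>lam\<close>, symmetry of the second derivatives of \<open>ln w\<close> makes the
  \<open>\<lambda>\<close>-derivative of \<open>L\<close> vanish at \<open>lam\<close>. In the product rule for \<open>\<partial>\<^sub>\<lambda> (L w)\<close> only the term
  \<open>L (\<partial>\<^sub>\<lambda> w) = K L w\<close> is left.
\<close>

lemma mixed_partial_w:
  assumes lam: "lam \<in> \<Lambda>" and \<theta>: "\<theta> \<in> \<Theta>" and t: "t \<in> J"
    and K_const: "\<And>h. h \<in> \<Theta> \<Longrightarrow> K_kernel \<Lambda> w lam h t = k"
  shows "partial1 \<Lambda> (partial2 \<Theta> (\<lambda>l h. w l h t)) lam \<theta> = k * L_kernel \<Theta> w lam \<theta> t * w lam \<theta> t"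
proof -
  let ?f = "\<lambda>l h. ln (w l h t)"
  have "partial2 \<Theta> (partial1 \<Lambda> ?f) lam \<theta> = 0"
  proof -
    have "((\<lambda>h. partial1 \<Lambda> ?f lam h) has_real_derivative 0) (at \<theta> within \<Theta>)"
      by (rule has_field_derivative_transform_within[OF DERIV_const[of k], where d = 1])
        (use \<theta> K_const in \<open>auto simp: K_kernel_def\<close>)
    then show ?thesis
      unfolding partial2_def by (intro vector_derivative_within_interval_eq interval_Theta \<theta>)
  qed
  then have "partial1 \<Lambda> (partial2 \<Theta> ?f) lam \<theta> = 0"
    using partial_derivatives_commute[OF interval_Lambda lam interval_Theta \<theta> C2[OF t]] by simp
  moreover have "(\<lambda>l. partial2 \<Theta> ?f l \<theta>) differentiable (at lam within \<Lambda>)"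
    using C2[OF t] lam \<theta> unfolding C2_on_rect_def C1_on_rect_def differentiable_on_def by auto
  ultimately have "((\<lambda>l. L_kernel \<Theta> w l \<theta> t) has_real_derivative 0) (at lam within \<Lambda>)"
    using has_real_derivative_vector_derivative[of "\<lambda>l. partial2 \<Theta> ?f l \<theta>" lam \<Lambda>]
    by (simp add: partial1_def L_kernel_def)
  then have "((\<lambda>l. L_kernel \<Theta> w l \<theta> t * w l \<theta> t) has_real_derivative
      k * L_kernel \<Theta> w lam \<theta> t * w lam \<theta> t) (at lam within \<Lambda>)"
    using has_derivative_w_lam[OF lam \<theta> t] K_const[OF \<theta>]
    by (auto intro!: derivative_eq_intros)
  then have "((\<lambda>l. partial2 \<Theta> (\<lambda>l h. w l h t) l \<theta>) has_real_derivative
      k * L_kernel \<Theta> w lam \<theta> t * w lam \<theta> t) (at lam within \<Lambda>)"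
    by (rule has_field_derivative_transform_within[where d = 1])
      (use lam \<theta> t partial2_w in auto)
  then show ?thesis
    unfolding partial1_def by (intro vector_derivative_within_interval_eq interval_Lambda lam)
qed

text \<open>
  The derivative of \<open>k t * w lam h t\<close> in \<open>h\<close> is the mixed derivative of \<open>w\<close>, which is dominated by
  hypothesis. This yields integrability of \<open>K L w\<close> as well, and with it the existence of the
  covariance; separate integrability of \<open>K w\<close> and \<open>L w\<close> would not suffice.
\<close>

lemma
  assumes lam: "lam \<in> \<Lambda>" and \<theta>: "\<theta> \<in> \<Theta>"
    and K_const: "\<And>h t. h \<in> \<Theta> \<Longrightarrow> t \<in> J \<Longrightarrow> K_kernel \<Lambda> w lam h t = k t"
  shows integrable_K_L_w: "integrable \<mu> (\<lambda>t. k t * L_kernel \<Theta> w lam \<theta> t * w lam \<theta> t)"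
    and has_derivative_integral_K_w: "((\<lambda>h. \<integral>t. k t * w lam h t \<partial>\<mu>) has_real_derivative
      (\<integral>t. k t * L_kernel \<Theta> w lam \<theta> t * w lam \<theta> t \<partial>\<mu>)) (at \<theta> within \<Theta>)"
proof -
  have int: "integrable \<mu> (\<lambda>t. k t * w lam h t)" if h: "h \<in> \<Theta>" for h
    using integrable_K_w[OF lam h] K_const[OF h]
    by (subst (asm) Bochner_Integration.integrable_cong[OF refl]) (auto simp: space_mu)
  have der: "((\<lambda>h. k t * w lam h t) has_real_derivative
      k t * L_kernel \<Theta> w lam h t * w lam h t) (at h within \<Theta>)" if "h \<in> \<Theta>" "t \<in> space \<mu>" for h t
    using has_derivative_w_theta[OF lam that(1), of t] that(2)
    by (auto intro!: derivative_eq_intros simp: space_mu)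
  have dom: "\<exists>m. integrable \<mu> m \<and>
      (AE t in \<mu>. \<forall>h\<in>{c..d}. \<bar>k t * L_kernel \<Theta> w lam h t * w lam h t\<bar> \<le> m t)"
    if cd: "{c..d} \<subseteq> \<Theta>" for c d
  proof -
    have "{lam..lam} \<times> {c..d} \<subseteq> \<Lambda> \<times> \<Theta>" using lam cd by auto
    from dominated_lam_theta[OF this] obtain m where m: "integrable \<mu> m"
      "AE t in \<mu>. \<forall>l\<in>{lam..lam}. \<forall>h\<in>{c..d}.
        \<bar>partial1 \<Lambda> (partial2 \<Theta> (\<lambda>l h. w l h t)) l h\<bar> \<le> m t"
      by auto
    have "AE t in \<mu>. \<forall>h\<in>{c..d}. \<bar>k t * L_kernel \<Theta> w lam h t * w lam h t\<bar> \<le> m t"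
      using m(2) AE_space
    proof eventually_elim
      case (elim t)
      then have t: "t \<in> J" by (simp add: space_mu)
      show ?case
      proof
        fix h assume h: "h \<in> {c..d}"
        then have "h \<in> \<Theta>" using cd by auto
        then have mixed: "partial1 \<Lambda> (partial2 \<Theta> (\<lambda>l h. w l h t)) lam h =
            k t * L_kernel \<Theta> w lam h t * w lam h t"
          using mixed_partial_w[OF lam _ t, of h "k t"] K_const t by simp
        have "\<bar>partial1 \<Lambda> (partial2 \<Theta> (\<lambda>l h. w l h t)) lam h\<bar> \<le> m t"
          using elim(1) h by simp
        then show "\<bar>k t * L_kernel \<Theta> w lam h t * w lam h t\<bar> \<le> m t"
          unfolding mixed .
      qed
    qed
    with m(1) show ?thesis by blast
  qed
  show "integrable \<mu> (\<lambda>t. k t * L_kernel \<Theta> w lam \<theta> t * w lam \<theta> t)"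
    by (rule integrable_dominated_derivative[of \<Theta> _ _ "\<lambda>h t. k t * w lam h t"])
      (fact interval_Theta \<theta> int der dom)+
  show "((\<lambda>h. \<integral>t. k t * w lam h t \<partial>\<mu>) has_real_derivative
      (\<integral>t. k t * L_kernel \<Theta> w lam \<theta> t * w lam \<theta> t \<partial>\<mu>)) (at \<theta> within \<Theta>)"
    by (rule has_real_derivative_dominated_integral)
      (fact interval_Theta \<theta> int der dom)+
qed

section \<open>Expectations under the law\<close>

lemma
  assumes lam: "lam \<in> \<Lambda>" and \<theta>: "\<theta> \<in> \<Theta>"
    and X: "X \<in> measurable M \<mu>" and law: "distr M \<mu> X = law \<mu> w lam \<theta>"
    and g: "integrable \<mu> (\<lambda>t. g t * w lam \<theta> t)"
  shows integrable_law: "integrable M (\<lambda>\<omega>. g (X \<omega>))"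
    and expectation_law: "(\<integral>\<omega>. g (X \<omega>) \<partial>M) = (\<integral>t. g t * w lam \<theta> t \<partial>\<mu>) / Phi \<mu> w lam \<theta>"
proof -
  have w: "w lam \<theta> \<in> borel_measurable \<mu>" "\<And>t. t \<in> space \<mu> \<Longrightarrow> w lam \<theta> t > 0"
    using w_measurable[OF lam \<theta>] w_pos[OF lam \<theta>] by (auto simp: space_mu)
  \<comment> \<open>Dividing by the positive weight shows that \<open>g\<close> itself is measurable.\<close>
  have "(\<lambda>t. g t * w lam \<theta> t / w lam \<theta> t) \<in> borel_measurable \<mu>"
    using w(1) borel_measurable_integrable[OF g] by measurable
  then have g_meas: "g \<in> borel_measurable \<mu>"
    by (rule measurable_cong[THEN iffD1, rotated]) (use w(2) in fastforce)
  let ?p = "\<lambda>t. w lam \<theta> t / Phi \<mu> w lam \<theta>"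
  have p: "?p \<in> borel_measurable \<mu>" "AE t in \<mu>. 0 \<le> ?p t"
    using w Phi_pos[OF lam \<theta>] by (auto intro!: AE_I2 less_imp_le)
  have gp: "(\<lambda>t. ?p t * g t) = (\<lambda>t. g t * w lam \<theta> t / Phi \<mu> w lam \<theta>)"
    by (auto simp: mult.commute)
  have "integrable (density \<mu> ?p) g"
    unfolding integrable_real_density[OF p g_meas] gp using g by simp
  then show "integrable M (\<lambda>\<omega>. g (X \<omega>))"
    using integrable_distr_eq[OF X g_meas] law by (simp add: law_def)
  have "(\<integral>\<omega>. g (X \<omega>) \<partial>M) = (\<integral>t. g t \<partial>density \<mu> ?p)"
    using integral_distr[OF X g_meas] law by (simp add: law_def)
  also have "\<dots> = (\<integral>t. ?p t * g t \<partial>\<mu>)"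
    by (rule integral_real_density[OF p g_meas])
  finally show "(\<integral>\<omega>. g (X \<omega>) \<partial>M) = (\<integral>t. g t * w lam \<theta> t \<partial>\<mu>) / Phi \<mu> w lam \<theta>"
    unfolding gp by simp
qed

end

lemma covariance_eq:
  assumes "prob_space M" "integrable M U" "integrable M V" "integrable M (\<lambda>\<omega>. U \<omega> * V \<omega>)"
  shows "covariance M U V = (\<integral>\<omega>. U \<omega> * V \<omega> \<partial>M) - (\<integral>\<omega>. U \<omega> \<partial>M) * (\<integral>\<omega>. V \<omega> \<partial>M)"
proof -
  interpret prob_space M by fact
  have "covariance M U V = (\<integral>\<omega>. U \<omega> * V \<omega> - expectation V * U \<omega> - expectation U * V \<omega>
      + expectation U * expectation V \<partial>M)"
    unfolding covariance_def by (intro Bochner_Integration.integral_cong) (auto simp: algebra_simps)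
  also have "\<dots> = expectation (\<lambda>\<omega>. U \<omega> * V \<omega>) - expectation V * expectation U
      - expectation U * expectation V + expectation U * expectation V"
    using assms(2-4) by (simp add: prob_space)
  finally show ?thesis by simp
qed

section \<open>The mixed logarithmic derivative as a covariance\<close>

theorem proposition2p16:
  fixes \<Lambda> \<Theta> J :: "real set"
    and \<mu> :: "real measure"
    and w :: "real \<Rightarrow> real \<Rightarrow> real \<Rightarrow> real"
    and M :: "'a measure"
    and X :: "'a \<Rightarrow> real"
    and lam \<theta> :: real
  assumes "weight_family \<Lambda> \<Theta> J \<mu> w"
    and "lam \<in> \<Lambda>" and "\<theta> \<in> \<Theta>"
    and "prob_space M"
    and "X \<in> measurable M \<mu>"
    and "distr M \<mu> X = law \<mu> w lam \<theta>"
    and "\<And>\<theta>\<^sub>1 \<theta>\<^sub>2 t. \<lbrakk>\<theta>\<^sub>1 \<in> \<Theta>; \<theta>\<^sub>2 \<in> \<Theta>; t \<in> J\<rbrakk> \<Longrightarrow>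
      K_kernel \<Lambda> w lam \<theta>\<^sub>1 t = K_kernel \<Lambda> w lam \<theta>\<^sub>2 t"
  shows "integrable M (\<lambda>\<omega>. K_kernel \<Lambda> w lam \<theta> (X \<omega>)) \<and>
     integrable M (\<lambda>\<omega>. L_kernel \<Theta> w lam \<theta> (X \<omega>)) \<and>
     integrable M (\<lambda>\<omega>. K_kernel \<Lambda> w lam \<theta> (X \<omega>) * L_kernel \<Theta> w lam \<theta> (X \<omega>)) \<and>
     (\<forall>\<theta>'\<in>\<Theta>. (\<lambda>lam'. ln (Phi \<mu> w lam' \<theta>')) differentiable (at lam within \<Lambda>)) \<and>
     (\<lambda>\<theta>'. partial1 \<Lambda> (\<lambda>l h. ln (Phi \<mu> w l h)) lam \<theta>') differentiable (at \<theta> within \<Theta>) \<and>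
     partial2 \<Theta> (partial1 \<Lambda> (\<lambda>l h. ln (Phi \<mu> w l h))) lam \<theta> =
       covariance M (\<lambda>\<omega>. K_kernel \<Lambda> w lam \<theta> (X \<omega>)) (\<lambda>\<omega>. L_kernel \<Theta> w lam \<theta> (X \<omega>))"
proof -
  interpret weight_family \<Lambda> \<Theta> J \<mu> w by fact
  note lam = assms(2) and \<theta> = assms(3) and X = assms(5) and law = assms(6)
  let ?K = "K_kernel \<Lambda> w lam \<theta>" and ?L = "L_kernel \<Theta> w lam \<theta>"
  let ?\<Phi> = "Phi \<mu> w lam \<theta>"
  let ?EK = "\<integral>\<omega>. ?K (X \<omega>) \<partial>M" and ?EL = "\<integral>\<omega>. ?L (X \<omega>) \<partial>M"
  let ?EKL = "\<integral>\<omega>. ?K (X \<omega>) * ?L (X \<omega>) \<partial>M"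
  have K_const: "K_kernel \<Lambda> w lam h t = ?K t" if "h \<in> \<Theta>" "t \<in> J" for h t
    using assms(7)[OF that(1) \<theta> that(2)] .
  note K_int = integrable_K_w[OF lam \<theta>] and L_int = integrable_L_w[OF lam \<theta>]
    and KL_int = integrable_K_L_w[OF lam \<theta> K_const]
  note intK = integrable_law[OF lam \<theta> X law K_int]
    and intL = integrable_law[OF lam \<theta> X law L_int]
    and intKL = integrable_law[OF lam \<theta> X law, where g = "\<lambda>t. ?K t * ?L t", OF KL_int]
  have \<Phi>: "?\<Phi> > 0" by (rule Phi_pos[OF lam \<theta>])
  have EK: "(\<integral>t. ?K t * w lam \<theta> t \<partial>\<mu>) = ?EK * ?\<Phi>"
    and EL: "(\<integral>t. ?L t * w lam \<theta> t \<partial>\<mu>) = ?EL * ?\<Phi>"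
    and EKL: "(\<integral>t. ?K t * ?L t * w lam \<theta> t \<partial>\<mu>) = ?EKL * ?\<Phi>"
    using expectation_law[OF lam \<theta> X law K_int] expectation_law[OF lam \<theta> X law L_int]
      expectation_law[OF lam \<theta> X law, where g = "\<lambda>t. ?K t * ?L t", OF KL_int] \<Phi> by simp_all
  have mean_K: "partial1 \<Lambda> (\<lambda>l h. ln (Phi \<mu> w l h)) lam h =
      (\<integral>t. ?K t * w lam h t \<partial>\<mu>) / Phi \<mu> w lam h" if h: "h \<in> \<Theta>" for h
  proof -
    have "(\<integral>t. K_kernel \<Lambda> w lam h t * w lam h t \<partial>\<mu>) = (\<integral>t. ?K t * w lam h t \<partial>\<mu>)"
      using K_const[OF h] by (intro Bochner_Integration.integral_cong) (auto simp: space_mu)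
    then show ?thesis
      using vector_derivative_within_interval_eq[OF interval_Lambda lam
          has_derivative_ln_Phi_lam[OF lam h]] by (simp add: partial1_def)
  qed
  have "((\<lambda>h. (\<integral>t. ?K t * w lam h t \<partial>\<mu>) / Phi \<mu> w lam h) has_real_derivative
      (?EKL * ?\<Phi> * ?\<Phi> - ?EK * ?\<Phi> * (?EL * ?\<Phi>)) / (?\<Phi> * ?\<Phi>)) (at \<theta> within \<Theta>)"
    using DERIV_divide[OF has_derivative_integral_K_w[OF lam \<theta> K_const]
        has_derivative_Phi_theta[OF lam \<theta>]] \<Phi> unfolding EK EL EKL by simp
  also have "(?EKL * ?\<Phi> * ?\<Phi> - ?EK * ?\<Phi> * (?EL * ?\<Phi>)) / (?\<Phi> * ?\<Phi>) = ?EKL - ?EK * ?EL"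
    using \<Phi> by (simp add: field_simps)
  also have "\<dots> = covariance M (\<lambda>\<omega>. ?K (X \<omega>)) (\<lambda>\<omega>. ?L (X \<omega>))"
    using covariance_eq[OF assms(4) intK intL intKL] by simp
  finally have main: "((\<lambda>h. partial1 \<Lambda> (\<lambda>l h. ln (Phi \<mu> w l h)) lam h) has_real_derivative
      covariance M (\<lambda>\<omega>. ?K (X \<omega>)) (\<lambda>\<omega>. ?L (X \<omega>))) (at \<theta> within \<Theta>)"
    by (rule has_field_derivative_transform_within[where d = 1]) (use \<theta> mean_K in auto)
  have "(\<lambda>l. ln (Phi \<mu> w l h)) differentiable (at lam within \<Lambda>)" if "h \<in> \<Theta>" for h
    using has_derivative_ln_Phi_lam[OF lam that] real_differentiable_def by blast
  moreover have "(\<lambda>h. partial1 \<Lambda> (\<lambda>l h. ln (Phi \<mu> w l h)) lam h) differentiable (at \<theta> within \<Theta>)"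
    using main real_differentiable_def by blast
  moreover have "partial2 \<Theta> (partial1 \<Lambda> (\<lambda>l h. ln (Phi \<mu> w l h))) lam \<theta> =
      covariance M (\<lambda>\<omega>. ?K (X \<omega>)) (\<lambda>\<omega>. ?L (X \<omega>))"
    unfolding partial2_def
    by (rule vector_derivative_within_interval_eq[OF interval_Theta \<theta> main])
  ultimately show ?thesis
    using intK intL intKL by blast
qed

end
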